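(* A graph $H$ is $i$-graph realizable if and only if each of its blocks is $i$-graph realizable.
   Context: All graphs are finite and simple. A block of a graph is a maximal connected subgraph without a cut vertex. For a graph $G$, $i(G)$ denotes the minimum cardinality of an independent dominating set of $G$; an independent dominating set of cardinality $i(G)$ is an $i$-set of $G$. The $i$-graph $\mathcal{I}(G)$ of $G$ is the graph whose vertices are the $i$-sets of $G$, where two $i$-sets $S$ and $S'$ are adjacent if and only if there is an edge $xy\in E(G)$ with $S'=(S-\{x\})\cup\{y\}$. A graph $H$ is $i$-graph realizable (is an $i$-graph) if there exists a graph $G$ with $\mathcal{I}(G)\cong H$. *)

theory Defs
  imports "Graph_Theory.Graph_Theory"
begin

text \<open>
  Finite simple graphs are the instances of the locale \<open>graph\<close>: an undirected edge \<open>xy\<close> is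
  a pair of opposite arcs, and \<open>x \<rightarrow>\<^bsub>G\<^esub> y\<close> means \<open>xy \<in> E(G)\<close>.  The locale admits the null
  graph; as usual in graph theory, the vertex set of a graph is taken to be nonempty here.
\<close>

definition nonnull_graph :: "('a, 'b) pre_digraph \<Rightarrow> bool" where
  "nonnull_graph G \<longleftrightarrow> graph G \<and> verts G \<noteq> {}"


section \<open>Blocks\<close>

text \<open>
  A cut vertex is one whose removal increases the number of components.  In a symmetric digraph
  the strongly connected components are the components.  (Defining cut vertices through
  \<open>\<not> connected (G - v)\<close> would be wrong for the one-vertex graph, since the null graph is not
  \<open>connected\<close> in the library.)
\<close>

definition cut_vertex :: "('a, 'b) pre_digraph \<Rightarrow> 'a \<Rightarrow> bool" where
  "cut_vertex G v \<longleftrightarrow> v \<in> verts G \<and>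
     card (pre_digraph.sccs_verts (pre_digraph.del_vert G v)) > card (pre_digraph.sccs_verts G)"

text \<open>
  Maximality refers to the subgraph relation.  The conjunct \<open>graph C\<close> is needed because
  \<open>subgraph\<close> also admits subdigraphs that are not symmetric.
\<close>

definition block :: "('a, 'b) pre_digraph \<Rightarrow> ('a, 'b) pre_digraph \<Rightarrow> bool" where
  "block G B \<longleftrightarrow>
     pre_digraph.max_subgraph G (\<lambda>C. graph C \<and> connected C \<and> (\<nexists>v. cut_vertex C v)) B"


section \<open>The i-graph\<close>

definition independent_set :: "('a, 'b) pre_digraph \<Rightarrow> 'a set \<Rightarrow> bool" where
  "independent_set G S \<longleftrightarrow> S \<subseteq> verts G \<and> (\<forall>x\<in>S. \<forall>y\<in>S. \<not> x \<rightarrow>\<^bsub>G\<^esub> y)"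

definition dominating_set :: "('a, 'b) pre_digraph \<Rightarrow> 'a set \<Rightarrow> bool" where
  "dominating_set G S \<longleftrightarrow> S \<subseteq> verts G \<and> (\<forall>y\<in>verts G - S. \<exists>x\<in>S. x \<rightarrow>\<^bsub>G\<^esub> y)"

definition i_number :: "('a, 'b) pre_digraph \<Rightarrow> nat" where
  "i_number G = Min (card ` {S. independent_set G S \<and> dominating_set G S})"

definition i_sets :: "('a, 'b) pre_digraph \<Rightarrow> 'a set set" where
  "i_sets G = {S. independent_set G S \<and> dominating_set G S \<and> card S = i_number G}"

text \<open>
  The condition \<open>S \<noteq> S'\<close> is not redundant: for an edge \<open>xy\<close> with \<open>y \<in> S\<close>, \<open>x \<notin> S\<close>, the set
  \<open>(S - {x}) \<union> {y}\<close> is \<open>S\<close> itself.  For distinct i-sets the equation forces \<open>x \<in> S\<close> and \<open>y \<notin> S\<close>.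
\<close>

definition i_graph :: "('a, 'b) pre_digraph \<Rightarrow> ('a set, 'a set \<times> 'a set) pre_digraph" where
  "i_graph G = with_proj \<lparr> pverts = i_sets G,
     parcs = {(S, S'). S \<in> i_sets G \<and> S' \<in> i_sets G \<and> S \<noteq> S' \<and>
                       (\<exists>x y. x \<rightarrow>\<^bsub>G\<^esub> y \<and> S' = (S - {x}) \<union> {y})} \<rparr>"

text \<open>
  Every finite simple graph is isomorphic to one with vertices in \<^typ>\<open>nat\<close>, so quantifying
  over those amounts to quantifying over all graphs.
\<close>

definition i_graph_realizable :: "('a, 'b) pre_digraph \<Rightarrow> bool" where
  "i_graph_realizable H \<longleftrightarrow>
     (\<exists>G :: nat pair_pre_digraph.
        nonnull_graph (with_proj G) \<and> digraph_iso (i_graph (with_proj G)) H)"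

end

theory Submission
  imports Defs
begin

text \<open>
  Two constructions suffice.  An i-set \<open>S\<close> of \<open>G\<close> is destroyed, and all others kept, by adding to
  \<open>G\<close> a vertex adjacent to exactly the vertices outside \<open>S\<close>; hence nonempty induced subgraphs of
  i-graphs are i-graphs, and blocks, being induced subgraphs by maximality, are covered.
  The i-graph of a disjoint union is the Cartesian product of the i-graphs.  Gluing two graphs at a
  vertex, or taking their disjoint union, gives an induced subgraph of their Cartesian product
  (for the disjoint union, multiplied further by a 4-cycle).  So every induced subgraph \<open>H[W]\<close> is an
  i-graph by induction on \<open>|W|\<close>: if it is connected without cut vertex it lies in a block,
  otherwise it is glued from smaller induced subgraphs along at most one vertex.
\<close>

section \<open>The i-graph up to isomorphism\<close>

text \<open>The adjacency condition of \<open>i_graph\<close>, freed from the arc encoding and from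
  membership in \<open>i_sets\<close>.\<close>

definition slide :: "('a, 'b) pre_digraph \<Rightarrow> 'a set \<Rightarrow> 'a set \<Rightarrow> bool" where
  "slide G S T \<longleftrightarrow> S \<noteq> T \<and> (\<exists>x y. x \<rightarrow>\<^bsub>G\<^esub> y \<and> T = (S - {x}) \<union> {y})"

text \<open>This is an isomorphism from the i-graph of \<open>G\<close> onto the graph with vertex
  set \<open>V\<close> and adjacency \<open>E\<close>. Working with a bare relation spares every
  construction the bookkeeping of arcs; values of \<open>E\<close> outside \<open>V\<close> are
  irrelevant.\<close>

definition realizes ::
  "('a, 'b) pre_digraph \<Rightarrow> ('a set \<Rightarrow> 'v) \<Rightarrow> 'v set \<Rightarrow> ('v \<Rightarrow> 'v \<Rightarrow> bool) \<Rightarrow> bool" where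
  "realizes G f V E \<longleftrightarrow>
     bij_betw f (i_sets G) V \<and> (\<forall>S\<in>i_sets G. \<forall>T\<in>i_sets G. slide G S T \<longleftrightarrow> E (f S) (f T))"

definition rel_realizable :: "'v set \<Rightarrow> ('v \<Rightarrow> 'v \<Rightarrow> bool) \<Rightarrow> bool" where
  "rel_realizable V E \<longleftrightarrow>
     (\<exists>(G :: nat pair_pre_digraph) f. nonnull_graph (with_proj G) \<and> realizes (with_proj G) f V E)"

lemma dominates_iff_arc: "x \<rightarrow>\<^bsub>G\<^esub> y \<longleftrightarrow> (\<exists>e\<in>arcs G. tail G e = x \<and> head G e = y)"
  by (auto simp: arcs_ends_conv)

lemma i_graph_dominates:
  "S \<rightarrow>\<^bsub>i_graph G\<^esub> T \<longleftrightarrow> S \<in> i_sets G \<and> T \<in> i_sets G \<and> slide G S T"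
  by (auto simp: i_graph_def slide_def arcs_ends_conv)

text \<open>Since \<open>H\<close> has no parallel arcs, an isomorphism is determined by its vertex
  map: the arc map can be rebuilt from the end points. From here on realizability is a property of a
  vertex set and a relation.\<close>

lemma i_graph_realizable_iff:
  assumes "graph H"
  shows "i_graph_realizable H \<longleftrightarrow> rel_realizable (verts H) (\<lambda>x y. x \<rightarrow>\<^bsub>H\<^esub> y)"
proof -
  interpret H: graph H by fact
  have "digraph_iso (i_graph (with_proj G)) H \<longleftrightarrow>
      (\<exists>f. realizes (with_proj G) f (verts H) (\<lambda>x y. x \<rightarrow>\<^bsub>H\<^esub> y))"
    for G :: "nat pair_pre_digraph"
  proof
    let ?I = "i_graph (with_proj G)"
    have vI: "verts ?I = i_sets (with_proj G)" by (simp add: i_graph_def)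
    assume "digraph_iso ?I H"
    then obtain h where h: "pre_digraph.digraph_isomorphism ?I h" and H: "H = app_iso h ?I"
      by (auto simp: digraph_iso_def)
    have inj: "inj_on (iso_verts h) (i_sets (with_proj G))"
      using h by (auto simp: pre_digraph.digraph_isomorphism_def vI)
    have wf: "wf_digraph ?I" using h by (auto simp: pre_digraph.digraph_isomorphism_def)
    have ends: "\<And>a. a \<in> arcs ?I \<Longrightarrow> tail H (iso_arcs h a) = iso_verts h (tail ?I a)
        \<and> head H (iso_arcs h a) = iso_verts h (head ?I a)"
      using h by (auto simp: pre_digraph.digraph_isomorphism_def H head_app_iso tail_app_iso)
    have arcsH: "arcs H = iso_arcs h ` arcs ?I" using H by (simp add: arcs_app_iso)
    have "S \<rightarrow>\<^bsub>?I\<^esub> T \<longleftrightarrow> iso_verts h S \<rightarrow>\<^bsub>H\<^esub> iso_verts h T"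
      if "S \<in> i_sets (with_proj G)" "T \<in> i_sets (with_proj G)" for S T
    proof -
      have "iso_verts h S \<rightarrow>\<^bsub>H\<^esub> iso_verts h T \<longleftrightarrow>
          (\<exists>a\<in>arcs ?I. iso_verts h (tail ?I a) = iso_verts h S \<and> iso_verts h (head ?I a) = iso_verts h T)"
        using ends by (auto simp: dominates_iff_arc arcsH)
      also have "\<dots> \<longleftrightarrow> (\<exists>a\<in>arcs ?I. tail ?I a = S \<and> head ?I a = T)"
        using inj that wf vI by (metis inj_onD wf_digraph.head_in_verts wf_digraph.tail_in_verts)
      finally show ?thesis by (simp only: dominates_iff_arc)
    qed
    then have "realizes (with_proj G) (iso_verts h) (verts H) (\<lambda>x y. x \<rightarrow>\<^bsub>H\<^esub> y)"
      using inj H vI by (auto simp: realizes_def bij_betw_def verts_app_iso i_graph_dominates)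
    then show "\<exists>f. realizes (with_proj G) f (verts H) (\<lambda>x y. x \<rightarrow>\<^bsub>H\<^esub> y)" by blast
  next
    let ?I = "i_graph (with_proj G)"
    have I: "verts ?I = i_sets (with_proj G)" "tail ?I = fst" "head ?I = snd"
        "\<And>S T. (S, T) \<in> arcs ?I \<longleftrightarrow>
          S \<in> i_sets (with_proj G) \<and> T \<in> i_sets (with_proj G) \<and> slide (with_proj G) S T"
      by (auto simp: i_graph_def slide_def)
    assume "\<exists>f. realizes (with_proj G) f (verts H) (\<lambda>x y. x \<rightarrow>\<^bsub>H\<^esub> y)"
    then obtain f where f: "bij_betw f (i_sets (with_proj G)) (verts H)"
      and E: "\<And>S T. S \<in> i_sets (with_proj G) \<Longrightarrow> T \<in> i_sets (with_proj G) \<Longrightarrow>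
          slide (with_proj G) S T \<longleftrightarrow> f S \<rightarrow>\<^bsub>H\<^esub> f T"
      by (auto simp: realizes_def)
    \<comment> \<open>Some arc of \<open>H\<close> between the images exists whenever
      \<open>S\<close> and \<open>T\<close> are adjacent. It is the only one, by
      \<open>H.no_multi_arcs\<close>, and this uniqueness is what makes \<open>g\<close> surjective
      below.\<close>
    define g where "g = (\<lambda>(S, T). SOME e. e \<in> arcs H \<and> tail H e = f S \<and> head H e = f T)"
    have g: "g a \<in> arcs H \<and> tail H (g a) = f (fst a) \<and> head H (g a) = f (snd a)"
      if "a \<in> arcs ?I" for a
    proof -
      obtain S T where a: "a = (S, T)" by (cases a)
      have "f S \<rightarrow>\<^bsub>H\<^esub> f T" using that I E a by auto
      then have "\<exists>e. e \<in> arcs H \<and> tail H e = f S \<and> head H e = f T" by (auto simp: dominates_iff_arc)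
      from someI_ex[OF this] show ?thesis by (simp add: a g_def)
    qed
    define h where "h = \<lparr>iso_verts = f, iso_arcs = g, iso_head = head H, iso_tail = tail H\<rparr>"
    have injf: "inj_on f (i_sets (with_proj G))" using f by (simp add: bij_betw_def)
    have injg: "inj_on g (arcs ?I)"
    proof (rule inj_onI)
      fix a b assume ab: "a \<in> arcs ?I" "b \<in> arcs ?I" "g a = g b"
      obtain S T S' T' where "a = (S, T)" "b = (S', T')" by (cases a, cases b)
      with ab g[of a] g[of b] I injf show "a = b" by (auto dest: inj_onD)
    qed
    have surj: "g ` arcs ?I = arcs H"
    proof (intro equalityI subsetI)
      fix e assume e: "e \<in> arcs H"
      then have "tail H e \<in> f ` i_sets (with_proj G)" "head H e \<in> f ` i_sets (with_proj G)"
        using f by (simp_all add: bij_betw_def)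
      then obtain S T where ST: "S \<in> i_sets (with_proj G)" "T \<in> i_sets (with_proj G)"
          "tail H e = f S" "head H e = f T"
        by blast
      then have "f S \<rightarrow>\<^bsub>H\<^esub> f T" using e by (auto simp: dominates_iff_arc)
      with ST E I have a: "(S, T) \<in> arcs ?I" by auto
      from g[OF this] ST e have "g (S, T) = e"
        by (intro H.no_multi_arcs) (auto simp: arc_to_ends_def)
      with a show "e \<in> g ` arcs ?I" by blast
    qed (use g in auto)
    have "wf_digraph ?I" by unfold_locales (use I in auto)
    then have "pre_digraph.digraph_isomorphism ?I h"
      using injf injg g I by (auto simp: pre_digraph.digraph_isomorphism_def h_def)
    moreover have "H = app_iso h ?I"
      using f surj by (auto simp: app_iso_def h_def I bij_betw_def)
    ultimately show "digraph_iso ?I H" by (auto simp: digraph_iso_def)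
  qed
  then show ?thesis by (auto simp: i_graph_realizable_def rel_realizable_def)
qed

section \<open>Graphs given by a relation\<close>

definition simple_graph :: "'a set \<Rightarrow> ('a \<Rightarrow> 'a \<Rightarrow> bool) \<Rightarrow> ('a, 'a \<times> 'a) pre_digraph" where
  "simple_graph V R = with_proj \<lparr> pverts = V, parcs = {(x, y). x \<in> V \<and> y \<in> V \<and> R x y} \<rparr>"

lemma verts_simple_graph [simp]: "verts (simple_graph V R) = V"
  by (simp add: simple_graph_def)

lemma dominates_simple_graph [simp]:
  "x \<rightarrow>\<^bsub>simple_graph V R\<^esub> y \<longleftrightarrow> x \<in> V \<and> y \<in> V \<and> R x y"
  by (auto simp: simple_graph_def)

lemma nonnull_simple_graph:
  assumes V: "finite V" "V \<noteq> {}" and irr: "\<And>x. x \<in> V \<Longrightarrow> \<not> R x x"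
    and symm: "\<And>x y. x \<in> V \<Longrightarrow> y \<in> V \<Longrightarrow> R x y \<Longrightarrow> R y x"
  shows "nonnull_graph (simple_graph V R)"
proof -
  let ?P = "\<lparr> pverts = V, parcs = {(x, y). x \<in> V \<and> y \<in> V \<and> R x y} \<rparr>"
  have "finite {(x, y). x \<in> V \<and> y \<in> V \<and> R x y}"
    by (rule finite_subset[of _ "V \<times> V"]) (use V(1) in auto)
  then have "pair_fin_digraph ?P" using V(1) by unfold_locales auto
  moreover have "pair_loopfree_digraph ?P" using irr by unfold_locales auto
  moreover have "pair_sym_digraph ?P"
    by unfold_locales (auto simp: symmetric_def intro!: symI symm)
  ultimately have "pair_graph ?P"
    by (simp add: pair_graph_def pair_digraph_def pair_pseudo_graph_def)
  then have "graph (with_proj ?P)" by (rule pair_graph.pair_graphD_graph)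
  with V(2) show ?thesis by (simp add: nonnull_graph_def simple_graph_def)
qed

section \<open>Independent dominating sets and minimality\<close>

definition ids :: "('a, 'b) pre_digraph \<Rightarrow> 'a set set" where
  "ids G = {S. independent_set G S \<and> dominating_set G S}"

lemma ids_subset_verts: "S \<in> ids G \<Longrightarrow> S \<subseteq> verts G"
  by (auto simp: ids_def independent_set_def)

lemma ids_iff: "S \<in> ids G \<longleftrightarrow> S \<subseteq> verts G \<and> (\<forall>x\<in>S. \<forall>y\<in>S. \<not> x \<rightarrow>\<^bsub>G\<^esub> y) \<and>
    (\<forall>y\<in>verts G - S. \<exists>x\<in>S. x \<rightarrow>\<^bsub>G\<^esub> y)"
  by (auto simp: ids_def independent_set_def dominating_set_def)

text \<open>Finiteness of \<open>ids G\<close> turns the minimum in \<open>i_number\<close> into a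
  comparison with each member, the form in which minimality is checked for all later
  constructions.\<close>

lemma i_sets_iff:
  assumes "finite (verts G)"
  shows "S \<in> i_sets G \<longleftrightarrow> S \<in> ids G \<and> (\<forall>T\<in>ids G. card S \<le> card T)"
proof -
  have "finite (ids G)"
    by (rule finite_subset[of _ "Pow (verts G)"]) (use assms in \<open>auto dest: ids_subset_verts\<close>)
  then have "S \<in> ids G \<Longrightarrow> card S = Min (card ` ids G) \<longleftrightarrow> (\<forall>T\<in>ids G. card S \<le> card T)"
    by (subst eq_commute, subst Min_eq_iff) auto
  then show ?thesis
    by (auto simp: i_sets_def i_number_def ids_def)
qed

lemma nonnull_finite: "nonnull_graph G \<Longrightarrow> finite (verts G)"
  by (auto simp: nonnull_graph_def graph_def digraph_def dest: fin_digraph.finite_verts)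

text \<open>The constructions below produce graphs on sum types, whereas realizability asks for
  vertices in \<open>nat\<close>. A copy along an injection of the finite vertex set into
  \<open>nat\<close> preserves independence, domination, cardinalities and slides.\<close>

lemma rel_realizableI:
  fixes G :: "('a, 'b) pre_digraph"
  assumes G: "nonnull_graph G" and f: "realizes G f V E"
  shows "rel_realizable V E"
proof -
  interpret G: graph G using G by (simp add: nonnull_graph_def)
  have fin: "finite (verts G)" by simp
  obtain g :: "'a \<Rightarrow> nat" where g: "inj_on g (verts G)"
    using finite_imp_inj_to_nat_seg[OF fin] by blast
  define k where "k = the_inv_into (verts G) g"
  have k: "\<And>x. x \<in> verts G \<Longrightarrow> k (g x) = x" using g by (simp add: k_def the_inv_into_f_f)
  \<comment> \<open>Adjacency of the copy is pulled back through \<open>k\<close>, the inverse of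
    \<open>g\<close> on the vertices of \<open>G\<close>.\<close>
  define P where "P = \<lparr> pverts = g ` verts G, parcs = {(x, y). x \<in> g ` verts G \<and> y \<in> g ` verts G \<and> k x \<rightarrow>\<^bsub>G\<^esub> k y} \<rparr>"
  have P: "with_proj P = simple_graph (g ` verts G) (\<lambda>x y. k x \<rightarrow>\<^bsub>G\<^esub> k y)"
    by (simp add: P_def simple_graph_def)
  have nP: "nonnull_graph (with_proj P)" unfolding P
    using G by (intro nonnull_simple_graph)
      (auto simp: nonnull_graph_def k dest: G.adj_not_same intro: G.graph_symmetric)
  have dom: "x \<in> verts G \<Longrightarrow> y \<in> verts G \<Longrightarrow> g x \<rightarrow>\<^bsub>with_proj P\<^esub> g y \<longleftrightarrow> x \<rightarrow>\<^bsub>G\<^esub> y" for x y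
    unfolding P by (simp add: k)
  have vP: "verts (with_proj P) = g ` verts G" unfolding P by simp
  have idsP: "g ` S \<in> ids (with_proj P) \<longleftrightarrow> S \<in> ids G" if "S \<subseteq> verts G" for S
  proof -
    have "g ` verts G - g ` S = g ` (verts G - S)" using g that by (simp add: inj_on_image_set_diff)
    moreover have "(\<exists>x\<in>S. g x \<rightarrow>\<^bsub>with_proj P\<^esub> g y) \<longleftrightarrow> (\<exists>x\<in>S. x \<rightarrow>\<^bsub>G\<^esub> y)" if "y \<in> verts G" for y
      using \<open>S \<subseteq> verts G\<close> that dom by blast
    moreover have "(\<forall>x\<in>S. \<forall>y\<in>S. \<not> g x \<rightarrow>\<^bsub>with_proj P\<^esub> g y) \<longleftrightarrow> (\<forall>x\<in>S. \<forall>y\<in>S. \<not> x \<rightarrow>\<^bsub>G\<^esub> y)"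
      using that dom by blast
    ultimately show ?thesis using that unfolding ids_iff vP by (simp add: image_mono)
  qed
  have ids_eq: "ids (with_proj P) = (`) g ` ids G"
  proof (intro equalityI subsetI)
    fix X assume X: "X \<in> ids (with_proj P)"
    then obtain S where "S \<subseteq> verts G" "X = g ` S"
      using ids_subset_verts[OF X] vP by (metis subset_imageE)
    with X idsP show "X \<in> (`) g ` ids G" by auto
  qed (use idsP ids_subset_verts in blast)
  have card: "S \<in> ids G \<Longrightarrow> card (g ` S) = card S" for S
    using g ids_subset_verts by (metis card_image inj_on_subset)
  have i_eq: "g ` S \<in> i_sets (with_proj P) \<longleftrightarrow> S \<in> i_sets G" if "S \<subseteq> verts G" for S
    using idsP[OF that] card nonnull_finite[OF nP] fin
    by (auto simp: i_sets_iff ids_eq)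
  have sub: "S \<in> i_sets G \<Longrightarrow> S \<subseteq> verts G" for S
    by (auto simp: i_sets_def independent_set_def)
  have i_img: "i_sets (with_proj P) = (`) g ` i_sets G"
  proof (intro equalityI subsetI)
    fix X assume X: "X \<in> i_sets (with_proj P)"
    then have "X \<in> ids (with_proj P)" using nonnull_finite[OF nP] i_sets_iff by blast
    then obtain S where S: "S \<in> ids G" "X = g ` S" using ids_eq by auto
    with X i_eq[of S] ids_subset_verts[of S G] show "X \<in> (`) g ` i_sets G" by auto
  qed (use i_eq sub in auto)
  have kg: "S \<subseteq> verts G \<Longrightarrow> k ` g ` S = S" for S using k by force
  have slide: "slide (with_proj P) (g ` S) (g ` T) \<longleftrightarrow> slide G S T"
    if "S \<in> i_sets G" "T \<in> i_sets G" for S T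
  proof -
    have ST: "S \<subseteq> verts G" "T \<subseteq> verts G" using that sub by auto
    have eq: "g ` T = g ` S - {g x} \<union> {g y} \<longleftrightarrow> T = S - {x} \<union> {y}"
      if "x \<in> verts G" "y \<in> verts G" for x y
    proof -
      have "g ` S - {g x} \<union> {g y} = g ` (S - {x} \<union> {y})"
        using inj_on_image_set_diff[OF g, of S "{x}"] ST that by auto
      moreover have "S - {x} \<union> {y} \<subseteq> verts G" using ST that by auto
      ultimately show ?thesis using g ST by (metis kg)
    qed
    have ne: "g ` S \<noteq> g ` T \<longleftrightarrow> S \<noteq> T" using ST kg by metis
    show ?thesis
    proof
      assume "slide (with_proj P) (g ` S) (g ` T)"
      then obtain x' y' where xy: "x' \<rightarrow>\<^bsub>with_proj P\<^esub> y'" "g ` T = g ` S - {x'} \<union> {y'}"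
        by (auto simp: slide_def)
      then obtain x y where "x \<in> verts G" "y \<in> verts G" "x' = g x" "y' = g y"
        unfolding P by auto
      then have "x \<rightarrow>\<^bsub>G\<^esub> y" "T = S - {x} \<union> {y}" using xy dom eq[of x y] by simp_all
      moreover have "S \<noteq> T" using ne \<open>slide (with_proj P) (g ` S) (g ` T)\<close> by (simp add: slide_def)
      ultimately show "slide G S T" unfolding slide_def by blast
    next
      assume "slide G S T"
      then obtain x y where "x \<rightarrow>\<^bsub>G\<^esub> y" "T = S - {x} \<union> {y}" "S \<noteq> T" by (auto simp: slide_def)
      moreover then have "x \<in> verts G" "y \<in> verts G"
        by (auto dest: G.adj_in_verts)
      ultimately have "g x \<rightarrow>\<^bsub>with_proj P\<^esub> g y" "g ` T = g ` S - {g x} \<union> {g y}" "g ` S \<noteq> g ` T"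
        using dom eq[of x y] ne by simp_all
      then show "slide (with_proj P) (g ` S) (g ` T)" unfolding slide_def by blast
    qed
  qed
  have "realizes (with_proj P) (f \<circ> (`) k) V E"
  proof -
    have "bij_betw ((`) k) (i_sets (with_proj P)) (i_sets G)"
      by (rule bij_betw_byWitness[where f' = "(`) g"]) (use sub kg in \<open>auto simp: i_img\<close>)
    moreover have "slide (with_proj P) X Y \<longleftrightarrow> E (f (k ` X)) (f (k ` Y))"
      if XY: "X \<in> i_sets (with_proj P)" "Y \<in> i_sets (with_proj P)" for X Y
    proof -
      obtain S T where "S \<in> i_sets G" "T \<in> i_sets G" "X = g ` S" "Y = g ` T"
        using XY unfolding i_img by blast
      moreover then have "k ` X = S" "k ` Y = T" using kg sub by blast+
      ultimately show ?thesis using slide f by (simp add: realizes_def)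
    qed
    ultimately show ?thesis
      using f unfolding realizes_def by (auto intro: bij_betw_trans)
  qed
  with nP show ?thesis unfolding rel_realizable_def by blast
qed


section \<open>Induced subgraphs\<close>

lemma i_setsD:
  assumes "S \<in> i_sets G"
  shows "S \<in> ids G" "S \<subseteq> verts G" "card S = i_number G"
  using assms by (auto simp: i_sets_def ids_def independent_set_def)

text \<open>If \<open>x\<close> were outside \<open>S\<close>, then \<open>S\<close> would be a
  subset of \<open>T\<close> of the same finite size, hence equal to \<open>T\<close>. Confining
  \<open>x\<close> and \<open>y\<close> to the two i-sets means that only adjacency between vertices
  of \<open>S\<close> and \<open>T\<close> matters when graphs are enlarged or combined.\<close>

lemma slide_i_sets_iff:
  assumes "finite (verts G)" "S \<in> i_sets G" "T \<in> i_sets G"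
  shows "slide G S T \<longleftrightarrow> S \<noteq> T \<and> (\<exists>x\<in>S. \<exists>y\<in>T. x \<rightarrow>\<^bsub>G\<^esub> y \<and> T = (S - {x}) \<union> {y})"
proof
  assume "slide G S T"
  then obtain x y where xy: "S \<noteq> T" "x \<rightarrow>\<^bsub>G\<^esub> y" "T = (S - {x}) \<union> {y}" by (auto simp: slide_def)
  have "x \<in> S"
  proof (rule ccontr)
    assume "x \<notin> S"
    then have "S \<subseteq> T" using xy by auto
    moreover have "finite T" "card S = card T"
      using i_setsD[OF assms(2)] i_setsD[OF assms(3)] assms(1) by (auto intro: finite_subset)
    ultimately show False using xy(1) card_subset_eq by metis
  qed
  with xy show "S \<noteq> T \<and> (\<exists>x\<in>S. \<exists>y\<in>T. x \<rightarrow>\<^bsub>G\<^esub> y \<and> T = (S - {x}) \<union> {y})" by auto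
qed (auto simp: slide_def)

section \<open>Destroying chosen i-sets by extra vertices\<close>

text \<open>All unwanted i-sets are destroyed at once, with one new vertex \<open>Inr T\<close> for
  each. The new vertices form a clique, so an independent set contains at most one of them.\<close>

fun forbid_adj :: "('a, 'b) pre_digraph \<Rightarrow> 'a + 'a set \<Rightarrow> 'a + 'a set \<Rightarrow> bool" where
  "forbid_adj G (Inl x) (Inl y) \<longleftrightarrow> x \<rightarrow>\<^bsub>G\<^esub> y"
| "forbid_adj G (Inl x) (Inr T) \<longleftrightarrow> x \<notin> T"
| "forbid_adj G (Inr S) (Inl y) \<longleftrightarrow> y \<notin> S"
| "forbid_adj G (Inr S) (Inr T) \<longleftrightarrow> S \<noteq> T"

definition forbid :: "('a, 'b) pre_digraph \<Rightarrow> 'a set set \<Rightarrow>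
    ('a + 'a set, ('a + 'a set) \<times> ('a + 'a set)) pre_digraph" where
  "forbid G Z = simple_graph (verts G <+> Z) (forbid_adj G)"

lemma nonnull_forbid:
  assumes "nonnull_graph G" "Z \<subseteq> i_sets G"
  shows "nonnull_graph (forbid G Z)"
  unfolding forbid_def
proof (rule nonnull_simple_graph)
  interpret G: graph G using assms(1) by (simp add: nonnull_graph_def)
  have "finite Z"
    by (rule finite_subset[of _ "Pow (verts G)"]) (use assms(2) i_setsD(2) in auto)
  then show "finite (verts G <+> Z)" by simp
  show "verts G <+> Z \<noteq> {}" using assms(1) by (auto simp: nonnull_graph_def)
  show "\<not> forbid_adj G x x" for x
    by (cases x) (use G.adj_not_same in auto)
  show "forbid_adj G x y \<Longrightarrow> forbid_adj G y x" for x y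
    by (cases x; cases y) (use G.graph_symmetric in auto)
qed

text \<open>A set of old vertices dominates \<open>Inr T\<close> iff it is not contained in
  \<open>T\<close>. As i-sets have equal size, none is properly contained in another, so exactly
  those in \<open>Z\<close> fail. An independent dominating set containing \<open>Inr T\<close> also
  contains a copy of \<open>T\<close>, which makes it too large by one. Because \<open>Z\<close> is
  a proper subset, some i-set survives and the minimum stays \<open>i_number G\<close>.\<close>

lemma i_sets_forbid:
  assumes G: "nonnull_graph G" and Z: "Z \<subset> i_sets G"
  shows "i_sets (forbid G Z) = (`) Inl ` (i_sets G - Z)"
proof -
  have fin: "finite (verts G)" using G by (rule nonnull_finite)
  have fin': "finite (verts (forbid G Z))" using nonnull_forbid[OF G] Z by (auto intro: nonnull_finite)
  have finS: "S \<in> ids G \<Longrightarrow> finite S" for S using ids_subset_verts fin finite_subset by metis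
  have old: "Inl ` S \<in> ids (forbid G Z) \<longleftrightarrow> S \<in> ids G \<and> (\<forall>T\<in>Z. \<not> S \<subseteq> T)" for S
  proof (cases "S \<subseteq> verts G")
    case True
    let ?D = "\<lambda>y. \<exists>x\<in>Inl ` S. x \<rightarrow>\<^bsub>forbid G Z\<^esub> y"
    have split: "(\<forall>y\<in>(verts G <+> Z) - Inl ` S. ?D y) \<longleftrightarrow>
        (\<forall>y\<in>verts G - S. ?D (Inl y)) \<and> (\<forall>T\<in>Z. ?D (Inr T))"
      unfolding Plus_def by blast
    have "?D (Inl y) \<longleftrightarrow> (\<exists>x\<in>S. x \<rightarrow>\<^bsub>G\<^esub> y)" if "y \<in> verts G" for y
      using True that by (auto simp: forbid_def)
    moreover have "?D (Inr T) \<longleftrightarrow> \<not> S \<subseteq> T" if "T \<in> Z" for T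
      using True that by (auto simp: forbid_def)
    moreover have "(\<forall>x\<in>Inl ` S. \<forall>y\<in>Inl ` S. \<not> x \<rightarrow>\<^bsub>forbid G Z\<^esub> y) \<longleftrightarrow> (\<forall>x\<in>S. \<forall>y\<in>S. \<not> x \<rightarrow>\<^bsub>G\<^esub> y)"
      using True by (auto simp: forbid_def subset_iff)
    moreover have "verts (forbid G Z) = verts G <+> Z" by (simp add: forbid_def)
    moreover have "Inl ` S \<subseteq> verts G <+> Z" using True by auto
    ultimately show ?thesis using True split by (simp add: ids_iff)
  qed (auto simp: ids_iff forbid_def)
  have new: "X \<in> ids (forbid G Z) \<Longrightarrow> Inr T \<in> X \<Longrightarrow> i_number G < card X" for X T
  proof -
    assume X: "X \<in> ids (forbid G Z)" and T: "Inr T \<in> X"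
    from X have XV: "X \<subseteq> verts G <+> Z" using ids_subset_verts by (force simp: forbid_def)
    with T have TZ: "T \<in> Z" by auto
    with Z have T': "T \<in> i_sets G" by auto
    \<comment> \<open>a neighbour of \<open>Inl x\<close> lying in \<open>X\<close> is nonadjacent to \<open>Inr T\<close>, so it is a vertex of \<open>T\<close>,
      contradicting the independence of \<open>T\<close>\<close>
    have "Inl x \<in> X" if "x \<in> T" for x
    proof (rule ccontr)
      assume "Inl x \<notin> X"
      moreover have xG: "x \<in> verts G" using that i_setsD(2)[OF T'] by auto
      ultimately have "Inl x \<in> (verts G <+> Z) - X" by auto
      moreover have "\<forall>y\<in>(verts G <+> Z) - X. \<exists>z\<in>X. forbid_adj G z y"
        using X by (simp add: ids_iff forbid_def) blast
      ultimately obtain z where z: "z \<in> X" "forbid_adj G z (Inl x)" by blast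
      have ind: "\<not> forbid_adj G (Inr T) z" using X T z(1) XV TZ
        by (auto simp: ids_iff forbid_def)
      show False
      proof (cases z)
        case (Inl w)
        with ind have "w \<in> T" by auto
        with that z(2) Inl i_setsD(1)[OF T'] show False by (auto simp: ids_iff)
      qed (use ind z that in auto)
    qed
    then have "insert (Inr T) (Inl ` T) \<subseteq> X" using T by auto
    moreover have "finite X" using X ids_subset_verts fin' finite_subset by metis
    ultimately have "card (insert (Inr T) (Inl ` T :: ('a + 'a set) set)) \<le> card X"
      by (rule card_mono[rotated])
    moreover have "card (insert (Inr T) (Inl ` T :: ('a + 'a set) set)) = Suc (card T)"
      using finS[OF i_setsD(1)[OF T']] by (subst card_insert_disjoint) (auto simp: card_image)
    ultimately show ?thesis using i_setsD(3)[OF T'] by simp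
  qed
  have shape: "\<exists>S. X = Inl ` S" if "X \<in> ids (forbid G Z)" "\<And>T. Inr T \<notin> X" for X
  proof
    show "X = Inl ` (Inl -` X)"
    proof (intro equalityI subsetI)
      fix z assume "z \<in> X"
      with that(2) show "z \<in> Inl ` (Inl -` X)" by (cases z) auto
    qed auto
  qed
  have keep: "Inl ` S \<in> ids (forbid G Z)" if "S \<in> i_sets G - Z" for S
  proof -
    have "\<not> S \<subseteq> T" if "T \<in> Z" for T
    proof
      assume "S \<subseteq> T"
      have T: "T \<in> i_sets G" using that Z by auto
      have "S = T"
        using card_subset_eq[OF finS \<open>S \<subseteq> T\<close>] i_setsD[OF T] \<open>S \<in> i_sets G - Z\<close> i_setsD[of S G] by auto
      with that \<open>S \<in> i_sets G - Z\<close> show False by auto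
    qed
    with that show ?thesis using old i_setsD(1) by auto
  qed
  have cardI: "card (Inl ` S :: ('a + 'a set) set) = card S" for S by (simp add: card_image)
  have low: "i_number G \<le> card X" if X: "X \<in> ids (forbid G Z)" for X
  proof (cases "\<exists>T. Inr T \<in> X")
    case False
    then obtain S where "X = Inl ` S" using shape[OF X] by auto
    moreover from Z obtain R where R: "R \<in> i_sets G" by auto
    ultimately show ?thesis
      using X old[of S] R i_setsD(3)[OF R] fin by (auto simp: i_sets_iff cardI)
  qed (use new X in force)
  show ?thesis
  proof (intro equalityI subsetI)
    fix X :: "('a + 'a set) set" assume X: "X \<in> (`) Inl ` (i_sets G - Z)"
    then obtain S where S: "S \<in> i_sets G - Z" "X = Inl ` S" by auto
    then have "card X = i_number G" using i_setsD(3)[of S G] by (simp add: cardI)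
    then show "X \<in> i_sets (forbid G Z)" using fin' S keep low by (simp add: i_sets_iff)
  next
    fix X assume "X \<in> i_sets (forbid G Z)"
    then have X: "X \<in> ids (forbid G Z)" "\<And>Y. Y \<in> ids (forbid G Z) \<Longrightarrow> card X \<le> card Y"
      using fin' by (auto simp: i_sets_iff)
    \<comment> \<open>The surviving i-set \<open>R\<close> bounds \<open>card X\<close> by
      \<open>i_number G\<close>, so by \<open>new\<close> no new vertex can lie in
      \<open>X\<close>.\<close>
    from Z obtain R where R: "R \<in> i_sets G - Z" by auto
    have "card X \<le> i_number G"
      using X(2)[OF keep[OF R]] R i_setsD(3)[of R G] by (simp add: cardI)
    then have "\<And>T. Inr T \<notin> X" using new[OF X(1)] by force
    then obtain S where S: "X = Inl ` S" using shape[OF X(1)] by auto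
    with X(1) old have SG: "S \<in> ids G" "\<forall>T\<in>Z. \<not> S \<subseteq> T" by auto
    have "card S \<le> card R" using \<open>card X \<le> i_number G\<close> S R i_setsD(3)[of R G] by (simp add: cardI)
    then have "S \<in> i_sets G" using SG R fin by (auto simp: i_sets_iff intro: le_trans)
    with SG S show "X \<in> (`) Inl ` (i_sets G - Z)" by auto
  qed
qed

text \<open>Forbidding the i-sets that \<open>f\<close> sends outside \<open>W\<close> leaves those
  over \<open>W\<close>. Slides between the survivors are unchanged, since they involve old vertices
  only.\<close>

lemma rel_realizable_subset:
  assumes "rel_realizable V E" "W \<subseteq> V" "W \<noteq> {}"
  shows "rel_realizable W E"
proof -
  obtain G :: "nat pair_pre_digraph" and f where G: "nonnull_graph (with_proj G)"
    and f: "realizes (with_proj G) f V E"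
    using assms(1) by (auto simp: rel_realizable_def)
  let ?G = "with_proj G"
  have inj: "inj_on f (i_sets ?G)" and surj: "f ` i_sets ?G = V"
    using f by (auto simp: realizes_def bij_betw_def)
  define Z where "Z = {S \<in> i_sets ?G. f S \<notin> W}"
  \<comment> \<open>Properness comes from \<open>W\<close> being nonempty and \<open>f\<close> being
    onto \<open>V\<close>.\<close>
  have Z: "Z \<subset> i_sets ?G" using assms(2,3) surj by (force simp: Z_def)
  have Y: "i_sets ?G - Z = {S \<in> i_sets ?G. f S \<in> W}" by (auto simp: Z_def)
  have nn: "nonnull_graph (forbid ?G Z)" using nonnull_forbid[OF G] Z by auto
  have fin: "finite (verts ?G)" using G by (rule nonnull_finite)
  have fin': "finite (verts (forbid ?G Z))" using nn by (rule nonnull_finite)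
  have img: "i_sets (forbid ?G Z) = (`) Inl ` {S \<in> i_sets ?G. f S \<in> W}"
    using i_sets_forbid[OF G Z] Y by simp
  have vi: "Inl -` (Inl ` S) = S" for S :: "nat set" by auto
  have sl: "slide (forbid ?G Z) (Inl ` S) (Inl ` T) \<longleftrightarrow> E (f S) (f T)"
    if ST: "S \<in> i_sets ?G" "T \<in> i_sets ?G" "f S \<in> W" "f T \<in> W" for S T
  proof -
    have eq: "Inl ` T = Inl ` S - {Inl x} \<union> {Inl y :: nat + nat set} \<longleftrightarrow> T = S - {x} \<union> {y}" for x y
    proof -
      have "Inl ` S - {Inl x} \<union> {Inl y :: nat + nat set} = Inl ` (S - {x} \<union> {y})" by auto
      then show ?thesis by (simp only: inj_image_eq_iff[OF inj_Inl])
    qed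
    have ST': "Inl ` S \<in> i_sets (forbid ?G Z)" "Inl ` T \<in> i_sets (forbid ?G Z)"
      using ST img by auto
    have dom: "Inl x \<rightarrow>\<^bsub>forbid ?G Z\<^esub> Inl y \<longleftrightarrow> x \<rightarrow>\<^bsub>?G\<^esub> y" if "x \<in> S" "y \<in> T" for x y
      using that i_setsD(2)[OF ST(1)] i_setsD(2)[OF ST(2)] by (auto simp: forbid_def)
    have "slide (forbid ?G Z) (Inl ` S) (Inl ` T) \<longleftrightarrow> slide ?G S T"
      unfolding slide_i_sets_iff[OF fin ST(1,2)] slide_i_sets_iff[OF fin' ST']
      by (simp only: bex_simps eq inj_image_eq_iff[OF inj_Inl]) (use dom in blast)
    also have "\<dots> \<longleftrightarrow> E (f S) (f T)" using f ST by (simp add: realizes_def)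
    finally show ?thesis .
  qed
  have "bij_betw (\<lambda>X. f (Inl -` X)) (i_sets (forbid ?G Z)) W"
    unfolding img bij_betw_def
  proof
    show "inj_on (\<lambda>X. f (Inl -` X)) ((`) Inl ` {S \<in> i_sets ?G. f S \<in> W} :: (nat + nat set) set set)"
      by (rule inj_onI) (auto simp: vi dest: inj_onD[OF inj])
    show "(\<lambda>X. f (Inl -` X)) ` ((`) Inl ` {S \<in> i_sets ?G. f S \<in> W} :: (nat + nat set) set set) = W"
      unfolding image_image vi using surj assms(2) by auto
  qed
  then have "realizes (forbid ?G Z) (\<lambda>X. f (Inl -` X)) W E"
    unfolding realizes_def by (auto simp: img vi sl)
  with nn show ?thesis by (rule rel_realizableI)
qed


section \<open>Cartesian products and gluing\<close>

text \<open>Combines passing to an induced subgraph with renaming vertices along \<open>h\<close>.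
  To realize a graph it is therefore enough to find it as an induced subgraph of a realizable
  one.\<close>

lemma rel_realizable_embed:
  assumes V: "rel_realizable V E" and h: "inj_on h W" "h ` W \<subseteq> V" "W \<noteq> {}"
    and E: "\<And>x y. x \<in> W \<Longrightarrow> y \<in> W \<Longrightarrow> F x y \<longleftrightarrow> E (h x) (h y)"
  shows "rel_realizable W F"
proof -
  have "rel_realizable (h ` W) E" using rel_realizable_subset[OF V h(2)] h(3) by simp
  then obtain G :: "nat pair_pre_digraph" and f where G: "nonnull_graph (with_proj G)"
    and f: "realizes (with_proj G) f (h ` W) E"
    by (auto simp: rel_realizable_def)
  define k where "k = the_inv_into W h"
  have k: "k (h x) = x" if "x \<in> W" for x using that h(1) by (simp add: k_def the_inv_into_f_f)
  have "bij_betw k (h ` W) W" unfolding k_def using h(1) by (simp add: bij_betw_the_inv_into inj_on_imp_bij_betw)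
  moreover have "slide (with_proj G) S T \<longleftrightarrow> F (k (f S)) (k (f T))"
    if ST: "S \<in> i_sets (with_proj G)" "T \<in> i_sets (with_proj G)" for S T
  proof -
    have "f S \<in> h ` W" "f T \<in> h ` W" using f ST by (auto simp: realizes_def bij_betw_def)
    then obtain x y where "x \<in> W" "y \<in> W" "f S = h x" "f T = h y" by blast
    then show ?thesis using f ST E k by (simp add: realizes_def)
  qed
  ultimately have "realizes (with_proj G) (k \<circ> f) W F"
    using f unfolding realizes_def by (auto intro: bij_betw_trans)
  with G show ?thesis unfolding rel_realizable_def by blast
qed

section \<open>Disjoint unions and Cartesian products\<close>

definition cartesian :: "('v \<Rightarrow> 'v \<Rightarrow> bool) \<Rightarrow> ('w \<Rightarrow> 'w \<Rightarrow> bool) \<Rightarrow> 'v \<times> 'w \<Rightarrow> 'v \<times> 'w \<Rightarrow> bool" where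
  "cartesian E F = (\<lambda>(a, b) (c, d). E a c \<and> b = d \<or> a = c \<and> F b d)"

fun sum_adj :: "('a, 'c) pre_digraph \<Rightarrow> ('b, 'd) pre_digraph \<Rightarrow> 'a + 'b \<Rightarrow> 'a + 'b \<Rightarrow> bool" where
  "sum_adj G H (Inl x) (Inl y) \<longleftrightarrow> x \<rightarrow>\<^bsub>G\<^esub> y"
| "sum_adj G H (Inr x) (Inr y) \<longleftrightarrow> x \<rightarrow>\<^bsub>H\<^esub> y"
| "sum_adj G H _ _ \<longleftrightarrow> False"

definition disjoint_sum :: "('a, 'c) pre_digraph \<Rightarrow> ('b, 'd) pre_digraph \<Rightarrow>
    ('a + 'b, ('a + 'b) \<times> ('a + 'b)) pre_digraph" where
  "disjoint_sum G H = simple_graph (verts G <+> verts H) (sum_adj G H)"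

lemma nonnull_disjoint_sum:
  assumes "nonnull_graph G" "nonnull_graph H"
  shows "nonnull_graph (disjoint_sum G H)"
  unfolding disjoint_sum_def
proof (rule nonnull_simple_graph)
  interpret G: graph G using assms(1) by (simp add: nonnull_graph_def)
  interpret H: graph H using assms(2) by (simp add: nonnull_graph_def)
  show "finite (verts G <+> verts H)" by simp
  show "verts G <+> verts H \<noteq> {}" using assms(1) by (auto simp: nonnull_graph_def)
  show "\<not> sum_adj G H x x" for x
    by (cases x) (use G.adj_not_same H.adj_not_same in auto)
  show "sum_adj G H x y \<Longrightarrow> sum_adj G H y x" for x y
    by (cases x; cases y) (use G.graph_symmetric H.graph_symmetric in auto)
qed

lemma Plus_vimage: "(Inl -` X) <+> (Inr -` X) = X"
proof (intro equalityI subsetI)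
  fix z assume "z \<in> X" then show "z \<in> (Inl -` X) <+> (Inr -` X)" by (cases z) auto
qed auto

lemma vimage_Plus [simp]: "Inl -` (S <+> T) = S" "Inr -` (S <+> T) = T"
  by auto

lemma Plus_eq_iff [simp]: "S <+> T = S' <+> T' \<longleftrightarrow> S = S' \<and> T = T'"
  by (metis vimage_Plus)

lemma Ball_Plus: "(\<forall>z\<in>S <+> T. P z) \<longleftrightarrow> (\<forall>x\<in>S. P (Inl x)) \<and> (\<forall>y\<in>T. P (Inr y))"
  by auto

lemma Bex_Plus: "(\<exists>z\<in>S <+> T. P z) \<longleftrightarrow> (\<exists>x\<in>S. P (Inl x)) \<or> (\<exists>y\<in>T. P (Inr y))"
  by auto

lemma dominates_disjoint_sum:
  assumes "nonnull_graph G" "nonnull_graph H"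
  shows "Inl x \<rightarrow>\<^bsub>disjoint_sum G H\<^esub> Inl y \<longleftrightarrow> x \<rightarrow>\<^bsub>G\<^esub> y"
    "Inr z \<rightarrow>\<^bsub>disjoint_sum G H\<^esub> Inr w \<longleftrightarrow> z \<rightarrow>\<^bsub>H\<^esub> w"
    "\<not> Inl x \<rightarrow>\<^bsub>disjoint_sum G H\<^esub> Inr w" "\<not> Inr w \<rightarrow>\<^bsub>disjoint_sum G H\<^esub> Inl x"
proof -
  interpret G: graph G using assms(1) by (simp add: nonnull_graph_def)
  interpret H: graph H using assms(2) by (simp add: nonnull_graph_def)
  show "Inl x \<rightarrow>\<^bsub>disjoint_sum G H\<^esub> Inl y \<longleftrightarrow> x \<rightarrow>\<^bsub>G\<^esub> y"
    "Inr z \<rightarrow>\<^bsub>disjoint_sum G H\<^esub> Inr w \<longleftrightarrow> z \<rightarrow>\<^bsub>H\<^esub> w"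
    "\<not> Inl x \<rightarrow>\<^bsub>disjoint_sum G H\<^esub> Inr w" "\<not> Inr w \<rightarrow>\<^bsub>disjoint_sum G H\<^esub> Inl x"
    by (auto simp: disjoint_sum_def dest: G.adj_in_verts H.adj_in_verts)
qed

text \<open>No edge joins the two summands, so independence and domination are decided in each
  summand separately.\<close>

lemma ids_disjoint_sum:
  assumes G: "nonnull_graph G" and H: "nonnull_graph H"
  shows "S <+> T \<in> ids (disjoint_sum G H) \<longleftrightarrow> S \<in> ids G \<and> T \<in> ids H"
proof -
  note dom = dominates_disjoint_sum[OF G H]
  have diff: "(verts G <+> verts H) - (S <+> T) = (verts G - S) <+> (verts H - T)" by auto
  have sub: "S <+> T \<subseteq> verts G <+> verts H \<longleftrightarrow> S \<subseteq> verts G \<and> T \<subseteq> verts H" by auto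
  have V: "verts (disjoint_sum G H) = verts G <+> verts H" by (simp add: disjoint_sum_def)
  show ?thesis
    unfolding ids_iff V diff sub Ball_Plus Bex_Plus by (auto simp: dom)
qed

text \<open>Cardinalities add up. Minimality of the sum yields minimality of one part by varying
  that part while the other stays fixed; conversely the two inequalities are added.\<close>

lemma i_sets_disjoint_sum:
  assumes G: "nonnull_graph G" and H: "nonnull_graph H"
  shows "S <+> T \<in> i_sets (disjoint_sum G H) \<longleftrightarrow> S \<in> i_sets G \<and> T \<in> i_sets H"
proof -
  note ids = ids_disjoint_sum[OF G H]
  have fin: "finite (verts G)" "finite (verts H)" "finite (verts (disjoint_sum G H))"
    using G H nonnull_disjoint_sum[OF G H] by (auto intro: nonnull_finite)
  have finids: "A \<in> ids G \<Longrightarrow> finite A" "B \<in> ids H \<Longrightarrow> finite B" for A B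
    using fin ids_subset_verts finite_subset by metis+
  have card: "A \<in> ids G \<Longrightarrow> B \<in> ids H \<Longrightarrow> card (A <+> B) = card A + card B" for A B
    using finids by (simp add: card_Plus)
  \<comment> \<open>By \<open>Plus_vimage\<close> every set of the sum type splits as
    \<open>A <+> B\<close>, so this covers all independent dominating sets.\<close>
  have all: "(\<forall>X\<in>ids (disjoint_sum G H). P X) \<longleftrightarrow> (\<forall>A\<in>ids G. \<forall>B\<in>ids H. P (A <+> B))" for P
    by (metis ids Plus_vimage)
  show ?thesis
  proof
    assume L: "S <+> T \<in> i_sets (disjoint_sum G H)"
    then have ST: "S \<in> ids G" "T \<in> ids H" using ids fin by (auto simp: i_sets_iff)
    from L have le: "\<And>A B. A \<in> ids G \<Longrightarrow> B \<in> ids H \<Longrightarrow> card S + card T \<le> card A + card B"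
      using fin ST by (auto simp: i_sets_iff all card)
    show "S \<in> i_sets G \<and> T \<in> i_sets H"
      using ST le[OF _ ST(2)] le[OF ST(1)] fin by (auto simp: i_sets_iff)
  next
    assume "S \<in> i_sets G \<and> T \<in> i_sets H"
    then show "S <+> T \<in> i_sets (disjoint_sum G H)"
      using fin by (auto simp: i_sets_iff all card ids intro: add_mono)
  qed
qed

text \<open>The edge used by a slide lies inside one summand, so the part in the other summand
  cannot change. This is the adjacency of a Cartesian product.\<close>

lemma slide_disjoint_sum:
  assumes G: "nonnull_graph G" and H: "nonnull_graph H"
    and S: "S \<in> i_sets G" "S' \<in> i_sets G" and T: "T \<in> i_sets H" "T' \<in> i_sets H"
  shows "slide (disjoint_sum G H) (S <+> T) (S' <+> T') \<longleftrightarrow>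
    slide G S S' \<and> T = T' \<or> S = S' \<and> slide H T T'"
proof -
  have fin: "finite (verts G)" "finite (verts H)" "finite (verts (disjoint_sum G H))"
    using G H nonnull_disjoint_sum[OF G H] by (auto intro: nonnull_finite)
  note isum = i_sets_disjoint_sum[OF G H, THEN iffD2, OF conjI]
  have L: "(S <+> T) - {Inl x} \<union> {Inl y} = (S - {x} \<union> {y}) <+> T" for x y by auto
  have R: "(S <+> T) - {Inr x} \<union> {Inr y} = S <+> (T - {x} \<union> {y})" for x y by auto
  show ?thesis
    unfolding slide_i_sets_iff[OF fin(1) S] slide_i_sets_iff[OF fin(2) T]
      slide_i_sets_iff[OF fin(3) isum[OF S(1) T(1)] isum[OF S(2) T(2)]]
      Bex_Plus L R Plus_eq_iff
    by (simp add: dominates_disjoint_sum[OF G H]) blast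
qed

lemma rel_realizable_cartesian:
  assumes "rel_realizable V E" "rel_realizable W F"
  shows "rel_realizable (V \<times> W) (cartesian E F)"
proof -
  obtain G H :: "nat pair_pre_digraph" and f g where
    G: "nonnull_graph (with_proj G)" and H: "nonnull_graph (with_proj H)"
    and f: "realizes (with_proj G) f V E" and g: "realizes (with_proj H) g W F"
    using assms by (auto simp: rel_realizable_def)
  let ?G = "with_proj G" and ?H = "with_proj H"
  let ?S = "disjoint_sum ?G ?H" and ?h = "\<lambda>X. (f (Inl -` X), g (Inr -` X))"
  have img: "i_sets ?S = (\<lambda>(S, T). S <+> T) ` (i_sets ?G \<times> i_sets ?H)" (is "?L = ?R")
  proof (intro equalityI subsetI)
    fix X assume "X \<in> ?L"
    then have "(Inl -` X) <+> (Inr -` X) \<in> ?L" by (simp only: Plus_vimage)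
    then have "(Inl -` X, Inr -` X) \<in> i_sets ?G \<times> i_sets ?H"
      using i_sets_disjoint_sum[OF G H] by simp
    then show "X \<in> ?R" by (rule rev_image_eqI) (simp add: Plus_vimage)
  qed (use i_sets_disjoint_sum[OF G H] in auto)
  have f': "inj_on f (i_sets ?G)" "f ` i_sets ?G = V" and g': "inj_on g (i_sets ?H)" "g ` i_sets ?H = W"
    using f g by (auto simp: realizes_def bij_betw_def)
  have "bij_betw ?h (i_sets ?S) (V \<times> W)"
    unfolding bij_betw_def
  proof
    show "inj_on ?h (i_sets ?S)" unfolding img
      by (rule inj_onI) (auto dest: inj_onD[OF f'(1)] inj_onD[OF g'(1)])
    show "?h ` i_sets ?S = V \<times> W" unfolding img image_image f'(2)[symmetric] g'(2)[symmetric]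
      by (auto simp: image_iff split_beta)
  qed
  moreover have "slide ?S X Y \<longleftrightarrow> cartesian E F (?h X) (?h Y)"
    if "X \<in> i_sets ?S" "Y \<in> i_sets ?S" for X Y
  proof -
    obtain S T S' T' where X: "X = S <+> T" "S \<in> i_sets ?G" "T \<in> i_sets ?H"
      and Y: "Y = S' <+> T'" "S' \<in> i_sets ?G" "T' \<in> i_sets ?H"
      using \<open>X \<in> i_sets ?S\<close> \<open>Y \<in> i_sets ?S\<close> unfolding img by auto
    have "S = S' \<longleftrightarrow> f S = f S'" "T = T' \<longleftrightarrow> g T = g T'"
      using X Y f' g' by (auto dest: inj_onD)
    moreover have "slide ?G S S' \<longleftrightarrow> E (f S) (f S')" "slide ?H T T' \<longleftrightarrow> F (g T) (g T')"
      using f g X Y by (auto simp: realizes_def)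
    ultimately show ?thesis
      unfolding X(1) Y(1) slide_disjoint_sum[OF G H X(2) Y(2) X(3) Y(3)] cartesian_def by simp
  qed
  ultimately have "realizes ?S ?h (V \<times> W) (cartesian E F)" by (simp add: realizes_def)
  with nonnull_disjoint_sum[OF G H] show ?thesis by (rule rel_realizableI)
qed

section \<open>Complete graphs and gluing along at most one vertex\<close>

text \<open>The i-sets of a complete graph are its singletons, and any two of them differ by a
  slide, so a complete graph is its own i-graph. The case of two vertices supplies the factors of
  the 4-cycle used for gluing.\<close>

lemma rel_realizable_complete:
  fixes K :: "'k set"
  assumes "finite K" "K \<noteq> {}"
  shows "rel_realizable K (\<noteq>)"
proof -
  let ?K = "simple_graph K (\<noteq>)"
  have nn: "nonnull_graph ?K" by (rule nonnull_simple_graph) (use assms in auto)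
  have ids: "ids ?K = (\<lambda>b. {b}) ` K"
  proof (intro equalityI subsetI)
    fix X assume X: "X \<in> ids ?K"
    then have "X \<noteq> {}" using assms(2) by (auto simp: ids_iff)
    then obtain b where "b \<in> X" by blast
    moreover have "X \<subseteq> K" "\<forall>x\<in>X. \<forall>y\<in>X. x = y" using X by (auto simp: ids_iff subset_iff)
    ultimately have "X = {b}" "b \<in> K" by auto
    then show "X \<in> (\<lambda>b. {b}) ` K" by blast
  qed (auto simp: ids_iff)
  have iK: "i_sets ?K = (\<lambda>b. {b}) ` K" using assms by (auto simp: i_sets_iff ids)
  have "bij_betw the_elem (i_sets ?K) K"
    unfolding iK bij_betw_def by (auto simp: inj_on_def image_image)
  moreover have "slide ?K {a} {b} \<longleftrightarrow> a \<noteq> b" if "a \<in> K" "b \<in> K" for a b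
    by (subst slide_i_sets_iff) (use that assms in \<open>auto simp: iK\<close>)
  ultimately have "realizes ?K the_elem K (\<noteq>)" by (auto simp: realizes_def iK)
  with nn show ?thesis by (rule rel_realizableI)
qed

text \<open>The union is embedded as an induced subgraph of a product containing \<open>A\<close>
  and \<open>B\<close> as fibres. Irreflexivity matters because a loop at the constant coordinate
  would put a loop on every vertex of a fibre.\<close>

lemma rel_realizable_glue:
  assumes A: "rel_realizable A E" "A \<noteq> {}" and B: "rel_realizable B E" "B \<noteq> {}"
    and one: "A \<inter> B \<subseteq> {v}" and irr: "\<And>x. \<not> E x x"
    and sep: "\<And>x y. x \<in> A - B \<Longrightarrow> y \<in> B - A \<Longrightarrow> \<not> E x y \<and> \<not> E y x"
  shows "rel_realizable (A \<union> B) E"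
proof (cases "A \<inter> B = {}")
  case True
  from A B obtain a b where ab: "a \<in> A" "b \<in> B" by blast
  \<comment> \<open>the two copies sit over opposite corners of the 4-cycle \<open>K\<^sub>2 \<times> K\<^sub>2\<close>, so no edge joins them\<close>
  let ?h = "\<lambda>x. if x \<in> A then ((x, b), (0 :: nat, 0 :: nat)) else ((a, x), (1, 1))"
  have "rel_realizable ((A \<times> B) \<times> {0 :: nat, 1} \<times> {0 :: nat, 1})
      (cartesian (cartesian E E) (cartesian (\<noteq>) (\<noteq>)))"
    by (intro rel_realizable_cartesian A B rel_realizable_complete) simp_all
  then show ?thesis
  proof (rule rel_realizable_embed)
    show "inj_on ?h (A \<union> B)" by (auto simp: inj_on_def)
    show "?h ` (A \<union> B) \<subseteq> (A \<times> B) \<times> {0 :: nat, 1} \<times> {0 :: nat, 1}" using ab by auto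
    show "A \<union> B \<noteq> {}" using A by auto
    show "E x y \<longleftrightarrow> cartesian (cartesian E E) (cartesian (\<noteq>) (\<noteq>)) (?h x) (?h y)"
      if "x \<in> A \<union> B" "y \<in> A \<union> B" for x y
      using that True sep[of x y] sep[of y x] irr by (auto simp: cartesian_def)
  qed
next
  case False
  with one have v: "A \<inter> B = {v}" by auto
  \<comment> \<open>The fibres of \<open>A\<close> and \<open>B\<close> through
    \<open>(v, v)\<close> meet only there. A vertex \<open>(x, v)\<close> and a vertex
    \<open>(v, y)\<close> with \<open>x\<close> and \<open>y\<close> both different from
    \<open>v\<close> differ in two coordinates and so are not adjacent, which matches
    \<open>sep\<close>.\<close>
  let ?h = "\<lambda>x. if x \<in> A then (x, v) else (v, x)"
  from A(1) B(1) have "rel_realizable (A \<times> B) (cartesian E E)" by (rule rel_realizable_cartesian)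
  then show ?thesis
  proof (rule rel_realizable_embed)
    show "inj_on ?h (A \<union> B)" using v by (auto simp: inj_on_def)
    show "?h ` (A \<union> B) \<subseteq> A \<times> B" using v by auto
    show "A \<union> B \<noteq> {}" using A by auto
    show "E x y \<longleftrightarrow> cartesian E E (?h x) (?h y)"
      if "x \<in> A \<union> B" "y \<in> A \<union> B" for x y
    proof -
      have "v \<in> A" "v \<in> B" "x \<in> A \<Longrightarrow> x \<in> B \<Longrightarrow> x = v" "y \<in> A \<Longrightarrow> y \<in> B \<Longrightarrow> y = v"
        using v by auto
      with that sep[of x y] sep[of y x] irr show ?thesis
        by (cases "x \<in> A"; cases "y \<in> A") (auto simp: cartesian_def)
    qed
  qed
qed


section \<open>Blocks\<close>

text \<open>Translates the component count of \<open>cut_vertex\<close> into reachability. The null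
  graph is included, with both sides false; it arises when the only vertex is deleted.\<close>

lemma (in fin_digraph) card_sccs_verts_gt_1_iff:
  "1 < card sccs_verts \<longleftrightarrow> (\<exists>u\<in>verts G. \<exists>v\<in>verts G. \<not> u \<rightarrow>\<^sup>* v)"
proof -
  have "card sccs_verts \<le> 1 \<longleftrightarrow> (\<forall>u\<in>verts G. \<forall>v\<in>verts G. scc_of u = scc_of v)"
    using finite_sccs_verts by (auto simp: card_le_Suc0_iff_eq sccs_verts_conv_scc_of)
  also have "\<dots> \<longleftrightarrow> (\<forall>u\<in>verts G. \<forall>v\<in>verts G. u \<rightarrow>\<^sup>* v)"
  proof (intro iffI ballI)
    fix u v assume "\<forall>u\<in>verts G. \<forall>v\<in>verts G. scc_of u = scc_of v" and uv: "u \<in> verts G" "v \<in> verts G"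
    then have "v \<in> scc_of u" using in_scc_of_self[of v] by blast
    then show "u \<rightarrow>\<^sup>* v" by (simp add: scc_of_def)
  next
    fix u v assume "\<forall>u\<in>verts G. \<forall>v\<in>verts G. u \<rightarrow>\<^sup>* v" and "u \<in> verts G" "v \<in> verts G"
    then show "scc_of u = scc_of v" by (intro scc_of_eq) (simp add: scc_of_def)
  qed
  finally show ?thesis by (auto simp: not_le[symmetric])
qed

lemma (in graph) connected_iff_reachable:
  "connected G \<longleftrightarrow> verts G \<noteq> {} \<and> (\<forall>u\<in>verts G. \<forall>v\<in>verts G. u \<rightarrow>\<^sup>* v)"
  using symmetric_connected_imp_strongly_connected[OF sym_arcs]
  by (auto simp: connected_def strongly_connected_def reachable_mk_symmetricI)

text \<open>A connected graph has exactly one component, so \<open>v\<close> is a cut vertex iff its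
  deletion leaves at least two, that is, two vertices with no walk between them.\<close>

lemma (in graph) cut_vertex_iff:
  assumes "connected G"
  shows "cut_vertex G v \<longleftrightarrow>
    v \<in> verts G \<and> (\<exists>x\<in>verts G - {v}. \<exists>y\<in>verts G - {v}. \<not> x \<rightarrow>\<^sup>*\<^bsub>del_vert v\<^esub> y)"
proof -
  interpret D: fin_digraph "del_vert v" by (rule fin_digraph_del_vert)
  have "verts G \<noteq> {}" "\<not> 1 < card sccs_verts"
    using assms connected_iff_reachable card_sccs_verts_gt_1_iff by auto
  then have "card sccs_verts = 1"
    using finite_sccs_verts by (simp add: sccs_verts_conv_scc_of card_gt_0_iff le_Suc_eq not_less)
  then show ?thesis
    using D.card_sccs_verts_gt_1_iff by (simp add: cut_vertex_def verts_del_vert)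
qed

text \<open>\<open>P\<close> is the set of vertices reachable from \<open>x\<close>. An arc leaving
  it would extend reachability, and by symmetry none enters it either.\<close>

lemma (in sym_digraph) unreachable_separation:
  assumes "x \<in> verts G" "y \<in> verts G" "\<not> x \<rightarrow>\<^sup>* y"
  obtains P Q where "P \<union> Q = verts G" "P \<inter> Q = {}" "x \<in> P" "y \<in> Q"
    "\<And>a b. a \<in> P \<Longrightarrow> b \<in> Q \<Longrightarrow> \<not> a \<rightarrow> b \<and> \<not> b \<rightarrow> a"
proof
  let ?P = "{z \<in> verts G. x \<rightarrow>\<^sup>* z}"
  show "?P \<union> (verts G - ?P) = verts G" "?P \<inter> (verts G - ?P) = {}" "x \<in> ?P" "y \<in> verts G - ?P"
    using assms by auto
  show "\<not> a \<rightarrow> b \<and> \<not> b \<rightarrow> a" if "a \<in> ?P" "b \<in> verts G - ?P" for a b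
    using that graph_symmetric[of b a] by (auto dest: reachable_adj_trans)
qed

text \<open>The property whose maximal subgraphs are the blocks. Single vertices and single edges
  satisfy it.\<close>

definition biconnected :: "('a, 'b) pre_digraph \<Rightarrow> bool" where
  "biconnected C \<longleftrightarrow> graph C \<and> connected C \<and> (\<nexists>v. cut_vertex C v)"

lemma block_altdef: "block G B \<longleftrightarrow> pre_digraph.max_subgraph G biconnected B"
  by (simp add: block_def biconnected_def[abs_def])

text \<open>Without connectedness the two sides are disjoint. Otherwise a cut vertex
  \<open>v\<close> is deleted, the rest is separated, and \<open>v\<close> is put back on both
  sides. Both sides are proper subsets, which drives the induction on the number of
  vertices.\<close>

lemma (in graph) not_biconnected_separation:
  assumes "verts G \<noteq> {}" "\<not> biconnected G"
  obtains A B v where "A \<union> B = verts G" "A \<noteq> {}" "B \<noteq> {}" "A \<subset> verts G" "B \<subset> verts G"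
    "A \<inter> B \<subseteq> {v}" "\<And>x y. x \<in> A - B \<Longrightarrow> y \<in> B - A \<Longrightarrow> \<not> x \<rightarrow> y \<and> \<not> y \<rightarrow> x"
proof (cases "connected G")
  case False
  then obtain x y where "x \<in> verts G" "y \<in> verts G" "\<not> x \<rightarrow>\<^sup>* y"
    using assms(1) connected_iff_reachable by auto
  then obtain P Q where PQ: "P \<union> Q = verts G" "P \<inter> Q = {}" "x \<in> P" "y \<in> Q"
    "\<And>a b. a \<in> P \<Longrightarrow> b \<in> Q \<Longrightarrow> \<not> a \<rightarrow> b \<and> \<not> b \<rightarrow> a"
    by (rule unreachable_separation) blast
  \<comment> \<open>\<open>P\<close> and \<open>Q\<close> are disjoint, so any value will do for the
    shared vertex.\<close>
  show ?thesis by (rule that[of P Q undefined]) (use PQ in auto)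
next
  case True
  then obtain v x y where v: "v \<in> verts G" and xy: "x \<in> verts G - {v}" "y \<in> verts G - {v}"
    "\<not> x \<rightarrow>\<^sup>*\<^bsub>del_vert v\<^esub> y"
    using assms(2) cut_vertex_iff graph_axioms by (auto simp: biconnected_def)
  have dom: "a \<rightarrow>\<^bsub>del_vert v\<^esub> b \<longleftrightarrow> a \<rightarrow> b \<and> a \<noteq> v \<and> b \<noteq> v" for a b
    by (auto simp: dominates_iff_arc del_vert_simps)
  have sym: "sym_digraph (del_vert v)"
    using wf_digraph_del_vert graph_symmetric
    by (intro wf_digraph.sym_digraphI) (auto simp: symmetric_def dom intro!: symI)
  have V: "verts (del_vert v) = verts G - {v}" by (simp add: verts_del_vert)
  obtain P Q where PQ: "P \<union> Q = verts G - {v}" "P \<inter> Q = {}" "x \<in> P" "y \<in> Q"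
    "\<And>a b. a \<in> P \<Longrightarrow> b \<in> Q \<Longrightarrow> \<not> a \<rightarrow>\<^bsub>del_vert v\<^esub> b \<and> \<not> b \<rightarrow>\<^bsub>del_vert v\<^esub> a"
    by (rule sym_digraph.unreachable_separation[OF sym, unfolded V, OF xy]) blast
  have "v \<notin> P" "v \<notin> Q" using PQ(1) by auto
  show ?thesis
  proof (rule that[of "insert v P" "insert v Q" v])
    show "\<not> a \<rightarrow> b \<and> \<not> b \<rightarrow> a" if "a \<in> insert v P - insert v Q" "b \<in> insert v Q - insert v P" for a b
      using that PQ(5)[of a b] dom by auto
  qed (use PQ v \<open>v \<notin> P\<close> \<open>v \<notin> Q\<close> in auto)
qed

section \<open>Blocks as induced subgraphs\<close>

lemma (in graph) graph_induce_subgraph: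
  assumes "W \<subseteq> verts G"
  shows "graph (G \<restriction> W)"
proof -
  have ind: "induced_subgraph (G \<restriction> W) G" using assms by (rule induced_induce)
  have "digraph (G \<restriction> W)" using ind by (rule digraphI_induced)
  moreover have "sym_digraph (G \<restriction> W)" using ind by (rule induced_graph_imp_graph)
  ultimately show ?thesis by (intro digraph.graphI) (auto dest: sym_digraph.sym_arcs)
qed

lemma dominates_induce_iff:
  "x \<rightarrow>\<^bsub>G \<restriction> W\<^esub> y \<longleftrightarrow> x \<rightarrow>\<^bsub>G\<^esub> y \<and> x \<in> W \<and> y \<in> W"
  by (auto simp: dominates_iff_arc)

text \<open>Additional arcs on the same vertices preserve walks, also after deleting a vertex
  \<open>v\<close>. So the larger graph stays connected, and any cut vertex of it would already be
  one of \<open>B\<close>.\<close>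

lemma biconnected_spanning:
  assumes B: "biconnected B" and G: "graph G" and sub: "subgraph B G" "verts B = verts G"
  shows "biconnected G"
proof -
  interpret B: graph B using B by (simp add: biconnected_def)
  interpret G: graph G by fact
  have conB: "connected B" using B by (simp add: biconnected_def)
  have con: "connected G"
    using G.connected_spanning_imp_connected conB sub by (auto simp: spanning_def)
  have "\<not> cut_vertex G v" for v
  proof
    assume "cut_vertex G v"
    then obtain x y where v: "v \<in> verts G" and xy: "x \<in> verts G - {v}" "y \<in> verts G - {v}"
      "\<not> x \<rightarrow>\<^sup>*\<^bsub>G.del_vert v\<^esub> y"
      using G.cut_vertex_iff[OF con] by auto
    have "subgraph (B.del_vert v) (G.del_vert v)"
      using sub B.wf_digraph_del_vert G.wf_digraph_del_vert
      by (auto simp: subgraph_def compatible_def B.del_vert_simps G.del_vert_simps)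
    then have "\<not> x \<rightarrow>\<^sup>*\<^bsub>B.del_vert v\<^esub> y"
      using xy(3) pre_digraph.reachable_mono by metis
    then have "cut_vertex B v" using v xy sub(2) B.cut_vertex_iff[OF conB] by auto
    with B show False by (simp add: biconnected_def)
  qed
  with con G show ?thesis by (simp add: biconnected_def)
qed

text \<open>The subgraph induced on \<open>verts B\<close> contains \<open>B\<close> as a spanning
  subgraph and is therefore biconnected too. Maximality makes it equal to \<open>B\<close>, so
  blocks are induced subgraphs.\<close>

lemma (in graph) block_dominates_iff:
  assumes "block G B" "x \<in> verts B" "y \<in> verts B"
  shows "x \<rightarrow>\<^bsub>B\<^esub> y \<longleftrightarrow> x \<rightarrow> y"
proof -
  have sub: "subgraph B G" and bic: "biconnected B"
    and max: "\<And>H. H \<noteq> B \<Longrightarrow> subgraph B H \<Longrightarrow> subgraph H G \<Longrightarrow> \<not> biconnected H"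
    using assms(1) by (auto simp: block_altdef max_subgraph_def)
  have V: "verts B \<subseteq> verts G" using sub by auto
  have "biconnected (G \<restriction> verts B)"
    using bic graph_induce_subgraph[OF V] subgraph_induce_subgraphI2[OF sub]
    by (rule biconnected_spanning) simp
  then have "G \<restriction> verts B = B"
    using max subgraph_induce_subgraphI2[OF sub] subgraph_induce_subgraphI[OF V] by blast
  with assms(2,3) show ?thesis using dominates_induce_iff by metis
qed

text \<open>Among the biconnected subgraphs above \<open>C\<close>, one of greatest size is maximal,
  sizes being bounded by that of the finite graph \<open>G\<close>.\<close>

lemma (in graph) exists_block:
  assumes C: "subgraph C G" "biconnected C"
  obtains B where "block G B" "subgraph C B"
proof -
  let ?P = "\<lambda>B. subgraph B G \<and> subgraph C B \<and> biconnected B"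
  \<comment> \<open>Arcs are counted as well, because a proper extension may have the same
    vertices.\<close>
  let ?f = "\<lambda>B :: ('a, 'b) pre_digraph. card (verts B) + card (arcs B)"
  have le: "card (verts B) \<le> card (verts D)" "card (arcs B) \<le> card (arcs D)"
    if "subgraph B D" "subgraph D G" for B D
  proof -
    have "finite (verts D)" "finite (arcs D)"
      using fin_digraph_subgraph[OF that(2)] by (auto intro: fin_digraph.finite_verts fin_digraph.finite_arcs)
    then show "card (verts B) \<le> card (verts D)" "card (arcs B) \<le> card (arcs D)"
      using that(1) by (auto intro: card_mono)
  qed
  have "?P C" using C by (auto intro: wf_digraph.subgraph_refl)
  \<comment> \<open>The bound has to be strict, and \<open>?f B\<close> may equal
    \<open>?f G\<close>.\<close>
  moreover have "?f B < Suc (?f G)" if "?P B" for B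
    using le[OF _ subgraph_refl, of B] that by (simp add: add_mono less_Suc_eq_le)
  ultimately have "\<exists>B. ?P B \<and> (\<forall>D. ?P D \<longrightarrow> ?f D \<le> ?f B)"
    by (intro ex_has_greatest_nat[of ?P C ?f "Suc (?f G)"]) blast+
  then obtain B where B: "?P B" and max: "\<And>D. ?P D \<Longrightarrow> ?f D \<le> ?f B" by blast
  have "D = B" if D: "subgraph B D" "subgraph D G" "biconnected D" for D
  proof -
    have "?f D \<le> ?f B" using max D B subgraph_trans by blast
    with le[OF D(1,2)] have "card (verts D) = card (verts B)" "card (arcs D) = card (arcs B)" by auto
    moreover have "finite (verts D)" "finite (arcs D)"
      using fin_digraph_subgraph[OF D(2)] by (auto intro: fin_digraph.finite_verts fin_digraph.finite_arcs)
    moreover have "verts B \<subseteq> verts D" "arcs B \<subseteq> arcs D" using D(1) by auto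
    ultimately have "verts D = verts B" "arcs D = arcs B" by (metis card_subset_eq)+
    \<comment> \<open>Compatibility of subgraphs supplies the equality of the \<open>tail\<close>
      and \<open>head\<close> functions.\<close>
    with D(1) show "D = B" by (auto simp: subgraph_def compatible_def)
  qed
  with B have "block G B" by (auto simp: block_altdef max_subgraph_def)
  with B that show ?thesis by blast
qed

section \<open>Assembling a graph from its blocks\<close>

text \<open>As blocks are induced, the adjacency of the whole graph may replace that of
  \<open>B\<close>. One relation then serves all blocks and all pieces being glued.\<close>

lemma (in graph) rel_realizable_block_iff:
  assumes "block G B"
  shows "i_graph_realizable B \<longleftrightarrow> rel_realizable (verts B) (\<lambda>x y. x \<rightarrow> y)"
proof -
  have B: "graph B" "verts B \<noteq> {}"
    using assms by (auto simp: block_altdef max_subgraph_def biconnected_def graph.connected_iff_reachable)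
  have *: "rel_realizable (verts B) E \<Longrightarrow> rel_realizable (verts B) F"
    if "\<And>x y. x \<in> verts B \<Longrightarrow> y \<in> verts B \<Longrightarrow> F x y \<longleftrightarrow> E x y" for E F
    by (rule rel_realizable_embed[of _ _ id]) (use that B in auto)
  note dom = block_dominates_iff[OF assms]
  show ?thesis
    unfolding i_graph_realizable_iff[OF B(1)] by (rule iffI; erule *[rotated]) (simp_all add: dom)
qed

lemma (in graph) rel_realizable_if_blocks:
  assumes blocks: "\<And>B. block G B \<Longrightarrow> i_graph_realizable B"
  shows "W \<subseteq> verts G \<Longrightarrow> W \<noteq> {} \<Longrightarrow> rel_realizable W (\<lambda>x y. x \<rightarrow> y)"
proof (induction "card W" arbitrary: W rule: less_induct)
  case less
  note W = less.prems
  have gW: "graph (G \<restriction> W)" using W(1) by (rule graph_induce_subgraph)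
  show ?case
  proof (cases "biconnected (G \<restriction> W)")
    case True
    \<comment> \<open>The block is taken in \<open>G\<close>, where realizability is assumed, and
      may be larger than the subgraph induced on \<open>W\<close>;
      \<open>rel_realizable_subset\<close> then cuts it down to \<open>W\<close>.\<close>
    with subgraph_induce_subgraphI[OF W(1)] obtain B where B: "block G B" "subgraph (G \<restriction> W) B"
      by (rule exists_block)
    have "W \<subseteq> verts B" using subgraph_imp_subverts[OF B(2)] by simp
    with rel_realizable_block_iff[OF B(1)] blocks[OF B(1)] show ?thesis
      using W(2) by (auto intro: rel_realizable_subset)
  next
    case False
    obtain A B v where AB: "A \<union> B = W" "A \<noteq> {}" "B \<noteq> {}" "A \<subset> W" "B \<subset> W" "A \<inter> B \<subseteq> {v}"
      and sep: "\<And>x y. x \<in> A - B \<Longrightarrow> y \<in> B - A \<Longrightarrow> \<not> x \<rightarrow>\<^bsub>G \<restriction> W\<^esub> y \<and> \<not> y \<rightarrow>\<^bsub>G \<restriction> W\<^esub> x"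
      using graph.not_biconnected_separation[OF gW _ False] W(2) by (metis induce_subgraph_verts)
    have "finite W" using W(1) finite_verts finite_subset by blast
    then have "card A < card W" "card B < card W" using AB(4,5) by (auto intro: psubset_card_mono)
    then have IH: "rel_realizable A (\<lambda>x y. x \<rightarrow> y)" "rel_realizable B (\<lambda>x y. x \<rightarrow> y)"
      using less.hyps AB W(1) by auto
    have "rel_realizable (A \<union> B) (\<lambda>x y. x \<rightarrow> y)"
    proof (rule rel_realizable_glue[OF IH(1) AB(2) IH(2) AB(3) AB(6)])
      show "\<not> x \<rightarrow> x" for x using adj_not_same by blast
      show "\<not> x \<rightarrow> y \<and> \<not> y \<rightarrow> x" if "x \<in> A - B" "y \<in> B - A" for x y
        using sep[OF that] that AB(1) by (auto simp: dominates_induce_iff)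
    qed
    with AB(1) show ?thesis by simp
  qed
qed

theorem theorem5p11:
  fixes H :: "('a, 'b) pre_digraph"
  assumes "nonnull_graph H"
  shows "i_graph_realizable H \<longleftrightarrow> (\<forall>B. block H B \<longrightarrow> i_graph_realizable B)"
proof -
  interpret graph H using assms by (simp add: nonnull_graph_def)
  note H = i_graph_realizable_iff[OF graph_axioms]
  show ?thesis
  proof (intro iffI allI impI)
    fix B assume "i_graph_realizable H" and B: "block H B"
    \<comment> \<open>Blocks are connected, hence nonempty, as the passage to an induced subgraph
      requires.\<close>
    moreover have "verts B \<subseteq> verts H" "verts B \<noteq> {}"
      using B by (auto simp: block_altdef max_subgraph_def biconnected_def graph.connected_iff_reachable)
    ultimately show "i_graph_realizable B"
      using rel_realizable_subset unfolding rel_realizable_block_iff[OF B] H by blast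
  next
    assume "\<forall>B. block H B \<longrightarrow> i_graph_realizable B"
    then show "i_graph_realizable H"
      unfolding H using rel_realizable_if_blocks assms by (auto simp: nonnull_graph_def)
  qed
qed

end
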